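(* (Halphen--Stolz inversion theorem.) Let $\eta(x^{1/n})$ and $\xi(y^{1/m})$ be Newton-Puiseux series of an irreducible formal power series $f(x,y)\in\mathbb{K}[[x,y]]$ relative to $x$ and to $y$ respectively, where $m,n\in\mathbb{N}^*$, $\eta(t)=(t\,\tilde\eta(t))^m$ and $\xi(u)=(u\,\tilde\xi(u))^n$ with $\tilde\eta(t)\in\mathbb{K}[[t]]^*$ and $\tilde\xi(u)\in\mathbb{K}[[u]]^*$ dual series, and $[\tilde\eta]_0=\tilde a$. Denote $$\mathrm{ess}(\eta(x^{1/n}),1)=\left(\tfrac mn,e_1,\dots,e_d\right),\qquad \mathrm{ess}(\xi(y^{1/m}),1)=\left(\tfrac nm,e'_1,\dots,e'_{d'}\right).$$ Then: (1) $d'=d$; (2) $m(1+e'_k)=n(1+e_k)$ for all $k\in\{1,\dots,d\}$; (3) $[\xi(y^{1/m})]_{n/m}=\tilde a^{-n}$ and $[\xi(y^{1/m})]_{e'_k}=-\dfrac nm\,\tilde a^{-(1+e_k)n}\,[\eta(x^{1/n})]_{e_k}$ for all $k\in\{1,\dots,d\}$.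
   Context: $\mathbb{K}$ is an algebraically closed field of characteristic zero; $\mathbb{N}^*$ is the set of positive integers. $\mathbb{K}[[t]]^*$ is the set of formal power series with non-zero constant term. For a series $\psi$ (with integral or rational exponents), $[\psi]_r$ is the coefficient of the monomial of exponent $r$, and the support $\mathcal{S}(\psi)$ is the set of exponents with non-zero coefficient. A Newton-Puiseux series in $x$ is a series $\eta(x^{1/n})$ with $\eta\in\mathbb{K}[[t]]$, $n\in\mathbb{N}^*$. If $f\in\mathbb{K}[[x,y]]$ satisfies $\mathrm{ord}_y f(0,y)=N\in\mathbb{N}^*$, its Weierstrass polynomial relative to $x$ is the unique monic polynomial $F\in\mathbb{K}[[x]][y]$ of degree $N$ with $f=\epsilon F$, $\epsilon$ a unit of $\mathbb{K}[[x,y]]$; the Newton-Puiseux series of $f$ relative to $x$ are the roots of $F$ in $\bigcup_{k\ge1}\mathbb{K}[[x^{1/k}]]$. Those relative to $y$ are defined symmetrically, exchanging the roles of $x$ and $y$. Dual: if $\phi\in\mathbb{K}[[t]]^*$, its dual is the unique series $\check{\phi}\in\mathbb{K}[[u]]^*$ such that $u\,\check{\phi}(u)$ and $t\,\phi(t)$ are inverse of each other for composition. For a non-empty $E\subset\mathbb{Q}_+$ with bounded denominators ($E\subset\frac1k\mathbb{N}$ for some $k\in\mathbb{N}^*$) and $p\in\mathbb{N}^*$, the sequence $\mathrm{ess}(E,p)=(e_0,e_1,\dots)$ of essential elements of $E$ relative to $p$ is defined inductively: $e_0=\min E$; for $l\ge1$, $e_l$ is defined if and only if $E\not\subset\mathbb{Z}\{p,e_0,\dots,e_{l-1}\}$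 (the subgroup generated), and then $e_l=\min(E\setminus\mathbb{Z}\{p,e_0,\dots,e_{l-1}\})$. For a non-zero Newton-Puiseux series $\psi$, $\mathrm{ess}(\psi,p):=\mathrm{ess}(\mathcal{S}(\psi),p)$. *)

theory Defs
  imports "HOL-Computational_Algebra.Computational_Algebra"
begin

subsection \<open>Newton-Puiseux series\<close>

text \<open>
  A series with rational exponents is represented by its coefficient function on \<^typ>\<open>rat\<close>;
  \<open>puiseux \<eta> n\<close> is the series \<open>\<eta>(x\<^sup>1\<^sup>/\<^sup>n)\<close>, whose coefficient at \<open>r\<close> is that of \<open>\<eta>\<close> at \<open>n r\<close>.
\<close>

definition puiseux :: "'a::zero fps \<Rightarrow> nat \<Rightarrow> rat \<Rightarrow> 'a" where
  "puiseux \<eta> n r = (if of_nat n * r \<in> \<nat> then fps_nth \<eta> (nat \<lfloor>of_nat n * r\<rfloor>) else 0)"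

definition puiseux_supp :: "(rat \<Rightarrow> 'a::zero) \<Rightarrow> rat set" where
  "puiseux_supp \<psi> = {r. \<psi> r \<noteq> 0}"

text \<open>
  \<^typ>\<open>'a fps fps\<close> is \<open>K[[x]][[y]] = K[[x, y]]\<close>: the outer variable is \<open>y\<close>, and
  \<open>fps_nth (fps_nth f j) i\<close> is the coefficient of \<open>x\<^sup>i y\<^sup>j\<close>. Similarly \<^typ>\<open>'a fps poly\<close> is \<open>K[[x]][y]\<close>.
\<close>

definition fps_swap :: "'a fps fps \<Rightarrow> 'a fps fps" where
  "fps_swap f = Abs_fps (\<lambda>i. Abs_fps (\<lambda>j. fps_nth (fps_nth f j) i))"

definition fps_at_x0 :: "'a fps fps \<Rightarrow> 'a fps" where
  "fps_at_x0 f = Abs_fps (\<lambda>j. fps_nth (fps_nth f j) 0)"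

definition weierstrass_poly :: "'a::field fps fps \<Rightarrow> 'a fps poly \<Rightarrow> bool" where
  "weierstrass_poly f F \<longleftrightarrow>
     fps_at_x0 f \<noteq> 0 \<and> subdegree (fps_at_x0 f) > 0 \<and>
     lead_coeff F = 1 \<and> degree F = subdegree (fps_at_x0 f) \<and>
     (\<exists>\<epsilon>. \<epsilon> dvd 1 \<and> f = \<epsilon> * fps_of_poly F)"

text \<open>
  The Newton-Puiseux series of \<open>f\<close> relative to \<open>x\<close>: the roots of its Weierstrass polynomial in the
  union over \<open>k \<ge> 1\<close> of the rings \<open>K[[x\<^sup>1\<^sup>/\<^sup>k]]\<close>. The ring \<open>K[[x\<^sup>1\<^sup>/\<^sup>k]]\<close> is \<open>K[[t]]\<close> with \<open>x = t\<^sup>k\<close>, so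
  the coefficients \<open>c(x)\<close> of the polynomial become \<open>c(t\<^sup>k)\<close>. Those relative to \<open>y\<close> are
  \<open>newton_puiseux_series (fps_swap f)\<close>.
\<close>

definition newton_puiseux_series :: "'a::field fps fps \<Rightarrow> (rat \<Rightarrow> 'a) set" where
  "newton_puiseux_series f =
     {puiseux \<eta> k | \<eta> k. k > 0 \<and>
        (\<exists>F. weierstrass_poly f F \<and> poly (map_poly (\<lambda>c. fps_compose c (fps_X ^ k)) F) \<eta> = 0)}"


subsection \<open>Dual series\<close>

definition dual_series :: "'a::field fps \<Rightarrow> 'a fps \<Rightarrow> bool" where
  "dual_series \<phi> \<psi> \<longleftrightarrow>
     fps_nth \<phi> 0 \<noteq> 0 \<and> fps_nth \<psi> 0 \<noteq> 0 \<and>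
     fps_compose (fps_X * \<phi>) (fps_X * \<psi>) = fps_X \<and>
     fps_compose (fps_X * \<psi>) (fps_X * \<phi>) = fps_X"


subsection \<open>Essential elements\<close>

text \<open>
  \<open>ess_rest E p es\<close> is \<open>E \ \<int>{p, es}\<close>, the set from which the essential element following those in
  \<open>es\<close> is chosen. The initial element is the minimum of \<open>E\<close> itself, even if it is a multiple of \<open>p\<close>.
\<close>

definition ess_rest :: "rat set \<Rightarrow> nat \<Rightarrow> rat list \<Rightarrow> rat set" where
  "ess_rest E p es = E - group_closure (insert (of_nat p) (set es))"

definition is_ess :: "rat set \<Rightarrow> nat \<Rightarrow> rat list \<Rightarrow> bool" where
  "is_ess E p es \<longleftrightarrow>
     es \<noteq> [] \<and> es ! 0 = (LEAST e. e \<in> E) \<and>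
     (\<forall>l\<in>{1..<length es}. ess_rest E p (take l es) \<noteq> {} \<and>
                          es ! l = (LEAST e. e \<in> ess_rest E p (take l es))) \<and>
     ess_rest E p es = {}"

definition ess :: "rat set \<Rightarrow> nat \<Rightarrow> rat list" where
  "ess E p = (THE es. is_ess E p es)"

text \<open>The sequence of essential elements is finite and uniquely determined.\<close>

lemma is_ess_take_eq:
  assumes "is_ess E p es" "is_ess E p es'" "l \<le> length es" "l \<le> length es'"
  shows "take l es = take l es'"
  using assms(3,4)
proof (induction l)
  case (Suc l)
  then have IH: "take l es = take l es'" by simp
  have "es ! l = es' ! l"
  proof (cases "l = 0")
    case True
    with assms(1,2) show ?thesis by (simp add: is_ess_def)
  next
    case False
    with Suc.prems have "l \<in> {1..<length es}" "l \<in> {1..<length es'}" by auto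
    with assms(1,2) have "es ! l = (LEAST e. e \<in> ess_rest E p (take l es))"
      "es' ! l = (LEAST e. e \<in> ess_rest E p (take l es'))"
      unfolding is_ess_def by blast+
    with IH show ?thesis by simp
  qed
  with IH Suc.prems show ?case by (simp add: take_Suc_conv_app_nth)
qed simp

lemma is_ess_length_le:
  assumes "is_ess E p es" "is_ess E p es'"
  shows "length es' \<le> length es"
proof (rule ccontr)
  assume "\<not> length es' \<le> length es"
  then have l: "length es < length es'" by simp
  have "es = take (length es) es'"
    using is_ess_take_eq[OF assms, of "length es"] l by simp
  moreover have "length es \<in> {1..<length es'}"
    using l assms(1) by (auto simp: is_ess_def Suc_le_eq)
  ultimately have "ess_rest E p es \<noteq> {}"
    using assms(2) unfolding is_ess_def by metis
  with assms(1) show False by (simp add: is_ess_def)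
qed

lemma is_ess_unique: "is_ess E p es \<Longrightarrow> is_ess E p es' \<Longrightarrow> es = es'"
  using is_ess_take_eq[of E p es es' "length es"] is_ess_length_le[of E p es es']
    is_ess_length_le[of E p es' es] by simp

lemma Least_in_bounded_denominators:
  fixes E :: "rat set"
  assumes "k > 0" "E \<subseteq> {of_nat j / of_nat k | j. True}" "E \<noteq> {}"
  shows "(LEAST e. e \<in> E) \<in> E" "\<And>e. e \<in> E \<Longrightarrow> (LEAST e. e \<in> E) \<le> e"
proof -
  define J where "J = {j. of_nat j / (of_nat k :: rat) \<in> E}"
  have ex: "\<exists>j. j \<in> J" using assms by (auto simp: J_def)
  define j where "j = (LEAST j. j \<in> J)"
  have j: "j \<in> J" "\<And>i. i \<in> J \<Longrightarrow> j \<le> i"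
    using ex unfolding j_def by (auto intro: LeastI_ex Least_le)
  have le: "of_nat j / of_nat k \<le> e" if "e \<in> E" for e
    using that assms(1,2) j(2) by (fastforce simp: J_def divide_right_mono)
  have eq: "(LEAST e. e \<in> E) = of_nat j / of_nat k"
    by (rule Least_equality) (use j le in \<open>auto simp: J_def\<close>)
  show "(LEAST e. e \<in> E) \<in> E" "\<And>e. e \<in> E \<Longrightarrow> (LEAST e. e \<in> E) \<le> e"
    using j le by (auto simp: eq J_def)
qed

lemma group_closure_mono: "A \<subseteq> B \<Longrightarrow> group_closure A \<subseteq> group_closure B"
proof
  fix x assume "x \<in> group_closure A" "A \<subseteq> B"
  then show "x \<in> group_closure B"
    by induction (auto intro: group_closure.intros)
qed

lemma group_closure_of_int_mult:
  fixes x :: rat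
  assumes "x \<in> group_closure S" shows "of_int i * x \<in> group_closure S"
proof (cases "i \<ge> 0")
  case True
  then show ?thesis using group_closure_scalar_mult_left[OF assms, of "nat i"] by simp
next
  case False
  then show ?thesis using group_closure_scalar_mult_left[OF assms, of "nat (- i)"]
      group_closure_minus_iff[of "of_int i * x" S] by simp
qed

lemma is_ess_exists:
  assumes k: "k > 0" and E: "E \<subseteq> {of_nat j / of_nat k | j. True}" "E \<noteq> {}" and p: "p > 0"
  shows "\<exists>es. is_ess E p es"
proof -
  define good where "good es \<longleftrightarrow> es \<noteq> [] \<and> es ! 0 = (LEAST e. e \<in> E) \<and>
     (\<forall>l\<in>{1..<length es}. ess_rest E p (take l es) \<noteq> {} \<and>
                          es ! l = (LEAST e. e \<in> ess_rest E p (take l es)))" for es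
  define B :: "rat set" where "B = (\<lambda>j. of_nat j / of_nat k) ` {..<k * p}"
  have B: "finite B" by (simp add: B_def)
  define \<mu> where "\<mu> es = card (B - group_closure (insert (of_nat p) (set es)))" for es :: "rat list"
  have "\<exists>es'. is_ess E p es'" if "good es" for es
    using that
  proof (induction "\<mu> es" arbitrary: es rule: less_induct)
    case less
    show ?case
    proof (cases "ess_rest E p es = {}")
      case True
      with less.prems show ?thesis by (auto simp: good_def is_ess_def)
    next
      case False
      define e where "e = (LEAST e. e \<in> ess_rest E p es)"
      have "e \<in> ess_rest E p es"
        unfolding e_def
        by (rule Least_in_bounded_denominators(1)[OF k]) (use False E in \<open>auto simp: ess_rest_def\<close>)
      then have e: "e \<in> E" "e \<notin> group_closure (insert (of_nat p) (set es))"
        by (auto simp: ess_rest_def)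
      have good': "good (es @ [e])"
        unfolding good_def
      proof (intro conjI ballI)
        show "es @ [e] \<noteq> []" by simp
        show "(es @ [e]) ! 0 = (LEAST e. e \<in> E)"
          using less.prems by (auto simp: good_def nth_append)
      next
        fix l assume l: "l \<in> {1..<length (es @ [e])}"
        show "ess_rest E p (take l (es @ [e])) \<noteq> {}"
          using l less.prems False by (cases "l = length es") (auto simp: good_def)
      next
        fix l assume l: "l \<in> {1..<length (es @ [e])}"
        show "(es @ [e]) ! l = (LEAST a. a \<in> ess_rest E p (take l (es @ [e])))"
          using l less.prems by (cases "l = length es") (auto simp: good_def nth_append e_def)
      qed
      let ?G = "group_closure (insert (rat_of_nat p) (set es))"
      let ?G' = "group_closure (insert (rat_of_nat p) (set (es @ [e])))"
      have sub: "?G \<subseteq> ?G'" by (rule group_closure_mono) auto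
      obtain j where j: "e = of_nat j / of_nat k" using e(1) E(1) by blast
      define r q where "r = j mod (k * p)" and "q = j div (k * p)"
      have jqr: "rat_of_nat j = of_nat q * (of_nat k * of_nat p) + of_nat r"
        unfolding r_def q_def by (metis div_mult_mod_eq of_nat_add of_nat_mult)
      define b where "b = (of_nat r / of_nat k :: rat)"
      have b_eq: "b = e - of_int (int q) * of_nat p"
        unfolding b_def j using jqr k by (simp add: field_simps)
      have bB: "b \<in> B" using k p by (auto simp: B_def b_def r_def)
      have pG: "of_int (int q) * of_nat p \<in> ?G"
        by (rule group_closure_of_int_mult) (auto intro: group_closure.base)
      have "b \<in> ?G'"
        unfolding b_eq by (rule group_closure.diff) (use pG sub in \<open>auto intro: group_closure.base\<close>)
      moreover have "b \<notin> ?G"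
      proof
        assume "b \<in> ?G"
        from group_closure_add[OF this pG] have "e \<in> ?G" by (simp add: b_eq)
        with e(2) show False by simp
      qed
      ultimately have "B - ?G' \<subset> B - ?G" using sub bB by blast
      then have "\<mu> (es @ [e]) < \<mu> es"
        unfolding \<mu>_def using B by (intro psubset_card_mono) auto
      from less.hyps[OF this good'] show ?thesis .
    qed
  qed
  moreover have "good [LEAST e. e \<in> E]" by (simp add: good_def)
  ultimately show ?thesis by blast
qed

lemma is_ess_ess:
  assumes "k > 0" "E \<subseteq> {of_nat j / of_nat k | j. True}" "E \<noteq> {}" "p > 0"
  shows "is_ess E p (ess E p)"
  unfolding ess_def using is_ess_exists[OF assms] is_ess_unique by (metis theI)

end

theory Submission
  imports Defs
begin

text \<open>
  Write \<open>\<eta> = t\<^sup>m \<phi>\<^sup>m\<close> and \<open>\<xi> = u\<^sup>n \<psi>\<^sup>n\<close> with \<open>\<phi>, \<psi>\<close> dual, and let \<open>H\<close> be a subgroup of the integers. If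
  \<open>i\<close> is not in \<open>H\<close> and all exponents of \<open>\<phi>\<close> below \<open>i\<close> lie in \<open>H\<close>, then the coefficients at \<open>i\<close> of
  \<open>\<phi>\<^sup>m\<close>, of \<open>\<psi>\<close> and of \<open>\<psi>\<^sup>n\<close> depend linearly on that of \<open>\<phi>\<close>; for \<open>\<psi>\<close> this is read off the identity
  \<open>\<phi>(t) \<psi>(t \<phi>(t)) = 1\<close>. Hence \<open>\<phi>\<^sup>m\<close> and \<open>\<psi>\<^sup>n\<close> have the same first exponent outside \<open>H\<close>. Taking for \<open>H\<close>
  the group generated by \<open>n\<close>, \<open>m\<close> and the essential exponents already found (scaled by the common
  denominator), one essential exponent after the other is transferred from \<open>\<eta>\<close> to \<open>\<xi>\<close>.
\<close>

subsection \<open>Exponents outside a subgroup\<close>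

text \<open>The bound \<open>j < i\<close> is strict: the coefficient at \<open>i\<close> stays
  free, as it is at the first exponent outside the subgroup. The subgroup lives in
  \<open>rat\<close> because \<open>S\<close> will be a set of rescaled essential exponents.\<close>

definition supp_within :: "rat set \<Rightarrow> nat \<Rightarrow> 'a::zero fps \<Rightarrow> bool" where
  "supp_within S i f \<longleftrightarrow> (\<forall>j<i. of_nat j \<notin> group_closure S \<longrightarrow> fps_nth f j = 0)"

lemma supp_withinD:
  "supp_within S i f \<Longrightarrow> j < i \<Longrightarrow> of_nat j \<notin> group_closure S \<Longrightarrow> fps_nth f j = 0"
  by (auto simp: supp_within_def)

lemma supp_within_mono: "supp_within S i f \<Longrightarrow> j \<le> i \<Longrightarrow> supp_within S j f"
  by (auto simp: supp_within_def)

lemma group_closure_diff_nat: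
  assumes "rat_of_nat i \<notin> group_closure S" "of_nat j \<in> group_closure S" "j \<le> i"
  shows "rat_of_nat (i - j) \<notin> group_closure S"
  using group_closure_add[of "of_nat (i - j)" S "of_nat j"] assms by (auto simp: of_nat_diff)

text \<open>If \<open>i\<close> is outside the subgroup, then for every \<open>j\<close> at least
  one of \<open>j\<close> and \<open>i - j\<close> is outside too, so all terms with
  \<open>0 < j < i\<close> vanish. Taking the coefficient at \<open>i\<close> thus obeys a Leibniz
  rule.\<close>

lemma fps_mult_nth_outside:
  fixes f g :: "'a::comm_ring_1 fps"
  assumes f: "supp_within S i f" and g: "supp_within S i g"
    and i: "of_nat i \<notin> group_closure S"
  shows "fps_nth (f * g) i = fps_nth f 0 * fps_nth g i + fps_nth f i * fps_nth g 0"
proof -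
  have "i \<noteq> 0" using i by (cases "i = 0") auto
  have "fps_nth f j * fps_nth g (i - j) = 0" if "j \<in> {0..i} - {0, i}" for j
  proof (cases "of_nat j \<in> group_closure S")
    case True
    then have "fps_nth g (i - j) = 0"
      using that by (intro supp_withinD[OF g] group_closure_diff_nat[OF i]) auto
    then show ?thesis by simp
  next
    case False
    with that show ?thesis using supp_withinD[OF f, of j] by auto
  qed
  then have "fps_nth (f * g) i = (\<Sum>j\<in>{0, i}. fps_nth f j * fps_nth g (i - j))"
    unfolding fps_mult_nth by (intro sum.mono_neutral_right) auto
  then show ?thesis using \<open>i \<noteq> 0\<close> by simp
qed

text \<open>Iterating this Leibniz rule gives \<open>k * f_0 ^ (k - 1) * f_i\<close>. The factor
  \<open>fps_nth f 0\<close> on the left avoids the exponent \<open>k - 1\<close>, which would be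
  truncated at \<open>k = 0\<close>.\<close>

lemma supp_within_power_nth:
  fixes f :: "'a::field_char_0 fps"
  assumes "supp_within S i f" "fps_nth f 0 \<noteq> 0"
  shows supp_within_power: "supp_within S i (f ^ k)"
    and fps_power_nth_outside: "of_nat i \<notin> group_closure S \<Longrightarrow>
      fps_nth (f ^ k) i * fps_nth f 0 = of_nat k * fps_nth f 0 ^ k * fps_nth f i"
proof -
  have "supp_within S i (f ^ k) \<and> (of_nat i \<notin> group_closure S \<longrightarrow>
      fps_nth (f ^ k) i * fps_nth f 0 = of_nat k * fps_nth f 0 ^ k * fps_nth f i)"
    using assms(1)
  proof (induction k arbitrary: i)
    case 0
    have "fps_nth (1 :: 'a fps) j = 0" if "of_nat j \<notin> group_closure S" for j
      using that by (cases "j = 0") auto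
    then show ?case by (auto simp: supp_within_def)
  next
    case (Suc k)
    \<comment> \<open>The formula is proved for all \<open>j \<le> i\<close>: for
      \<open>j < i\<close> it shows that the power keeps its support in the subgroup, and
      \<open>j = i\<close> is the second claim.\<close>
    have *: "fps_nth (f ^ Suc k) j * fps_nth f 0 = of_nat (Suc k) * fps_nth f 0 ^ Suc k * fps_nth f j"
      if "j \<le> i" "of_nat j \<notin> group_closure S" for j
    proof -
      have "supp_within S j f" using Suc.prems that(1) by (rule supp_within_mono)
      with Suc.IH[of j] that(2)
      have IH: "fps_nth (f ^ k) j * fps_nth f 0 = of_nat k * fps_nth f 0 ^ k * fps_nth f j"
        and "fps_nth (f ^ Suc k) j = fps_nth f 0 * fps_nth (f ^ k) j + fps_nth f j * fps_nth (f ^ k) 0"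
        by (auto simp: fps_mult_nth_outside)
      then have "fps_nth (f ^ Suc k) j * fps_nth f 0 =
          fps_nth f 0 * (fps_nth (f ^ k) j * fps_nth f 0) + fps_nth f j * fps_nth f 0 ^ k * fps_nth f 0"
        by (simp add: algebra_simps fps_nth_power_0)
      then show ?thesis unfolding IH by (simp add: algebra_simps)
    qed
    moreover have "supp_within S i (f ^ Suc k)"
      unfolding supp_within_def
    proof (intro allI impI)
      fix j assume j: "j < i" "of_nat j \<notin> group_closure S"
      with Suc.prems have "fps_nth f j = 0" by (rule supp_withinD)
      with *[of j] j assms(2) show "fps_nth (f ^ Suc k) j = 0" by simp
    qed
    ultimately show ?case by blast
  qed
  then show "supp_within S i (f ^ k)" and "of_nat i \<notin> group_closure S \<Longrightarrow>
      fps_nth (f ^ k) i * fps_nth f 0 = of_nat k * fps_nth f 0 ^ k * fps_nth f i"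
    by auto
qed

text \<open>By strong induction: once \<open>f\<close> is known to behave below \<open>j\<close>,
  its coefficient at \<open>j\<close> is a non-zero multiple of that of \<open>f ^ k\<close>, since
  \<open>k\<close> is invertible in characteristic zero.\<close>

lemma supp_within_root:
  fixes f :: "'a::field_char_0 fps"
  assumes fk: "supp_within S i (f ^ k)" and f0: "fps_nth f 0 \<noteq> 0" and "k > 0"
  shows "supp_within S i f"
proof -
  have "of_nat j \<notin> group_closure S \<Longrightarrow> fps_nth f j = 0" if "j < i" for j
    using that
  proof (induction j rule: less_induct)
    case (less j)
    then have "supp_within S j f" by (auto simp: supp_within_def)
    from fps_power_nth_outside[OF this f0 less.prems(1), of k]
    show ?case using supp_withinD[OF fk less.prems(2,1)] f0 \<open>k > 0\<close> by simp
  qed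
  then show ?thesis by (simp add: supp_within_def)
qed


subsection \<open>Dual series\<close>

lemma dual_series_sym: "dual_series \<phi> \<psi> \<Longrightarrow> dual_series \<psi> \<phi>"
  by (auto simp: dual_series_def)

lemma dual_series_mult_compose:
  fixes \<phi> \<psi> :: "'a::field fps"
  assumes "dual_series \<phi> \<psi>"
  shows "\<phi> * (\<psi> oo (fps_X * \<phi>)) = 1"
proof -
  have "fps_X * (\<phi> * (\<psi> oo (fps_X * \<phi>))) = (fps_X * \<psi>) oo (fps_X * \<phi>)"
    by (simp add: fps_compose_mult_distrib mult.assoc)
  also have "\<dots> = fps_X * 1" using assms by (simp add: dual_series_def)
  finally show ?thesis by (simp only: mult_cancel_left) simp
qed

lemma dual_series_nth_0:
  fixes \<phi> \<psi> :: "'a::field fps"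
  assumes "dual_series \<phi> \<psi>"
  shows "fps_nth \<phi> 0 * fps_nth \<psi> 0 = 1"
  using arg_cong[OF dual_series_mult_compose[OF assms], of "\<lambda>f. fps_nth f 0"] by simp

text \<open>The coefficient is the sum of \<open>\<psi>_j\<close> times the coefficient of
  \<open>\<phi> ^ j\<close> at \<open>i - j\<close>. For \<open>j < i\<close>, the first factor
  vanishes if \<open>j\<close> is outside the subgroup and the second if \<open>j\<close> is inside.
  Only \<open>j = i\<close> survives.\<close>

lemma fps_compose_X_mult_nth_outside:
  fixes \<phi> \<psi> :: "'a::field_char_0 fps"
  assumes \<phi>: "supp_within S i \<phi>" and \<psi>: "supp_within S i \<psi>" and "fps_nth \<phi> 0 \<noteq> 0"
    and i: "of_nat i \<notin> group_closure S"
  shows "fps_nth (\<psi> oo (fps_X * \<phi>)) i = fps_nth \<psi> i * fps_nth \<phi> 0 ^ i"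
proof -
  have nth: "fps_nth ((fps_X * \<phi>) ^ j) i = fps_nth (\<phi> ^ j) (i - j)" if "j \<le> i" for j
    using that by (simp add: power_mult_distrib fps_X_power_mult_nth)
  have "fps_nth \<psi> j * fps_nth ((fps_X * \<phi>) ^ j) i = 0" if "j \<in> {0..i} - {i}" for j
  proof (cases "of_nat j \<in> group_closure S")
    case True
    then have *: "of_nat (i - j) \<notin> group_closure S"
      using that by (intro group_closure_diff_nat[OF i]) auto
    have "fps_nth (\<phi> ^ j) (i - j) = 0"
    \<comment> \<open>For \<open>j = 0\<close> the bound \<open>i - j < i\<close> fails, but
      \<open>\<phi> ^ 0 = 1\<close> has no coefficient at \<open>i > 0\<close>.\<close>
    proof (cases "j = 0")
      case False
      then show ?thesis
        using that * by (intro supp_withinD[OF supp_within_power[OF \<phi> assms(3)]]) auto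
    qed (use that in auto)
    then show ?thesis using that nth by simp
  next
    case False
    with that show ?thesis using supp_withinD[OF \<psi>, of j] by auto
  qed
  then have "fps_nth (\<psi> oo (fps_X * \<phi>)) i = (\<Sum>j\<in>{i}. fps_nth \<psi> j * fps_nth ((fps_X * \<phi>) ^ j) i)"
    unfolding fps_compose_nth by (intro sum.mono_neutral_right) auto
  then show ?thesis by (simp add: nth fps_nth_power_0)
qed

text \<open>The Leibniz rule applied to \<open>\<phi> * (\<psi> oo (fps_X * \<phi>)) = 1\<close> at
  \<open>i\<close> gives
  \<open>\<phi>_0 * \<psi>_i * \<phi>_0 ^ i + \<phi>_i * \<psi>_0 = 0\<close>. Multiplying by
  \<open>\<phi>_0\<close> and using \<open>\<phi>_0 * \<psi>_0 = 1\<close> yields the exponent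
  \<open>i + 2\<close>.\<close>

lemma dual_series_nth_outside:
  fixes \<phi> \<psi> :: "'a::field_char_0 fps"
  assumes dual: "dual_series \<phi> \<psi>" and \<phi>: "supp_within S i \<phi>" and \<psi>: "supp_within S i \<psi>"
    and i: "of_nat i \<notin> group_closure S"
  shows "fps_nth \<psi> i * fps_nth \<phi> 0 ^ (i + 2) = - fps_nth \<phi> i"
proof -
  let ?\<chi> = "\<psi> oo (fps_X * \<phi>)"
  have \<phi>0: "fps_nth \<phi> 0 \<noteq> 0" using dual by (simp add: dual_series_def)
  have \<chi>: "fps_nth ?\<chi> j = fps_nth \<psi> j * fps_nth \<phi> 0 ^ j" if "j \<le> i" "of_nat j \<notin> group_closure S" for j
    using that \<phi> \<psi> \<phi>0 by (intro fps_compose_X_mult_nth_outside) (auto intro: supp_within_mono)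
  then have "supp_within S i ?\<chi>"
    using \<psi> by (auto simp: supp_within_def)
  from fps_mult_nth_outside[OF \<phi> this i] \<chi>[OF order.refl i]
  have "fps_nth \<phi> 0 * (fps_nth \<psi> i * fps_nth \<phi> 0 ^ i) + fps_nth \<phi> i * fps_nth \<psi> 0 = fps_nth (1 :: 'a fps) i"
    using dual_series_mult_compose[OF dual] by simp
  also have "\<dots> = 0" using i by (cases "i = 0") auto
  finally have "fps_nth \<phi> 0 * (fps_nth \<phi> 0 * (fps_nth \<psi> i * fps_nth \<phi> 0 ^ i) + fps_nth \<phi> i * fps_nth \<psi> 0) = 0"
    by simp
  then have "fps_nth \<psi> i * fps_nth \<phi> 0 ^ (i + 2) + fps_nth \<phi> i * (fps_nth \<phi> 0 * fps_nth \<psi> 0) = 0"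
    by (simp add: algebra_simps power2_eq_square)
  then show ?thesis using dual_series_nth_0[OF dual] by (simp add: eq_neg_iff_add_eq_0)
qed

lemma supp_within_dual:
  fixes \<phi> \<psi> :: "'a::field_char_0 fps"
  assumes dual: "dual_series \<phi> \<psi>" and \<phi>: "supp_within S i \<phi>"
  shows "supp_within S i \<psi>"
proof -
  have "of_nat j \<notin> group_closure S \<Longrightarrow> fps_nth \<psi> j = 0" if "j < i" for j
    using that
  proof (induction j rule: less_induct)
    case (less j)
    then have "supp_within S j \<psi>" by (auto simp: supp_within_def)
    moreover have "supp_within S j \<phi>" using \<phi> less.prems by (auto intro: supp_within_mono)
    moreover have "fps_nth \<phi> j = 0" using supp_withinD[OF \<phi> less.prems(2,1)] .
    ultimately show ?case
      using dual_series_nth_outside[OF dual, of S j] less.prems dual by (simp add: dual_series_def)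
  qed
  then show ?thesis by (simp add: supp_within_def)
qed

text \<open>Passing from \<open>\<phi> ^ m\<close> to \<open>\<phi>\<close>, then to
  \<open>\<psi>\<close>, then to \<open>\<psi> ^ n\<close> multiplies the coefficient at
  \<open>i\<close> by \<open>1 / (m * a ^ (m - 1))\<close>, by \<open>- 1 / a ^ (i + 2)\<close> and
  by \<open>n / a ^ (n - 1)\<close>. The powers of \<open>a\<close> add up to
  \<open>- (m + n + i)\<close>.\<close>

lemma dual_series_power_nth_outside:
  fixes \<phi> \<psi> :: "'a::field_char_0 fps"
  assumes dual: "dual_series \<phi> \<psi>" and "m > 0" and \<phi>m: "supp_within S i (\<phi> ^ m)"
    and i: "of_nat i \<notin> group_closure S"
  shows "fps_nth (\<psi> ^ n) i =
    - (of_nat n / of_nat m) * fps_nth \<phi> 0 powi (- int (m + n + i)) * fps_nth (\<phi> ^ m) i"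
proof -
  define a where "a = fps_nth \<phi> 0"
  have a: "a \<noteq> 0" and \<psi>0: "fps_nth \<psi> 0 = inverse a" "fps_nth \<psi> 0 \<noteq> 0"
    using dual dual_series_nth_0[OF dual] by (auto simp: a_def dual_series_def field_simps)
  have \<phi>: "supp_within S i \<phi>" using supp_within_root[OF \<phi>m] a \<open>m > 0\<close> by (simp add: a_def)
  have \<psi>: "supp_within S i \<psi>" by (rule supp_within_dual[OF dual \<phi>])
  have 1: "fps_nth (\<phi> ^ m) i * a = of_nat m * a ^ m * fps_nth \<phi> i"
    using fps_power_nth_outside[OF \<phi> _ i] a by (simp add: a_def)
  have 2: "fps_nth (\<psi> ^ n) i = of_nat n * a * inverse a ^ n * fps_nth \<psi> i"
    using fps_power_nth_outside[OF \<psi> \<psi>0(2) i, of n] a by (simp add: \<psi>0(1) field_simps)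
  have 3: "fps_nth \<psi> i * a ^ (i + 2) = - fps_nth \<phi> i"
    using dual_series_nth_outside[OF dual \<phi> \<psi> i] by (simp add: a_def)
  have "fps_nth (\<psi> ^ n) i * a ^ (n + i + 1) = of_nat n * (fps_nth \<psi> i * a ^ (i + 2))"
    unfolding 2 using a by (simp add: power_add field_simps)
  also have "\<dots> = - of_nat n * fps_nth \<phi> i" unfolding 3 by simp
  finally have "fps_nth (\<psi> ^ n) i * a ^ (n + i + 1) * (of_nat m * a ^ m) =
      - of_nat n * (of_nat m * a ^ m * fps_nth \<phi> i)" by simp
  also have "\<dots> = - of_nat n * (fps_nth (\<phi> ^ m) i * a)" unfolding 1 ..
  finally have "a * (of_nat m * a ^ (m + n + i) * fps_nth (\<psi> ^ n) i) = a * (- of_nat n * fps_nth (\<phi> ^ m) i)"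
    by (simp add: power_add algebra_simps)
  then have "of_nat m * a ^ (m + n + i) * fps_nth (\<psi> ^ n) i = - of_nat n * fps_nth (\<phi> ^ m) i"
    using a by (simp only: mult_cancel_left) simp
  then have "fps_nth (\<psi> ^ n) i = - (of_nat n / of_nat m) * inverse (a ^ (m + n + i)) * fps_nth (\<phi> ^ m) i"
    using a \<open>m > 0\<close> by (simp add: field_simps)
  then show ?thesis by (simp only: a_def power_int_minus power_int_of_nat)
qed

section \<open>The first exponent outside a subgroup\<close>

definition supp_outside :: "rat set \<Rightarrow> 'a::zero fps \<Rightarrow> nat set" where
  "supp_outside S f = {i. fps_nth f i \<noteq> 0 \<and> of_nat i \<notin> group_closure S}"

text \<open>The coefficient formula is valid at every outside exponent up to \<open>i\<close>. Below
  \<open>i\<close> it makes the coefficients of \<open>\<psi> ^ n\<close> vanish; at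
  \<open>i\<close> it gives a non-zero multiple of a non-zero coefficient.\<close>

lemma dual_series_Least_supp_outside:
  fixes \<phi> \<psi> :: "'a::field_char_0 fps"
  assumes dual: "dual_series \<phi> \<psi>" and mn: "m > 0" "n > 0" and ne: "supp_outside S (\<phi> ^ m) \<noteq> {}"
  defines "i \<equiv> LEAST i. i \<in> supp_outside S (\<phi> ^ m)"
  shows "i \<in> supp_outside S (\<psi> ^ n)" and "(LEAST i. i \<in> supp_outside S (\<psi> ^ n)) = i"
    and "fps_nth (\<psi> ^ n) i =
      - (of_nat n / of_nat m) * fps_nth \<phi> 0 powi (- int (m + n + i)) * fps_nth (\<phi> ^ m) i"
proof -
  have i: "i \<in> supp_outside S (\<phi> ^ m)" and least: "\<And>j. j \<in> supp_outside S (\<phi> ^ m) \<Longrightarrow> i \<le> j"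
    using ne unfolding i_def by (auto intro: LeastI Least_le)
  have \<phi>: "supp_within S i (\<phi> ^ m)"
    using least by (force simp: supp_within_def supp_outside_def)
  have a: "fps_nth \<phi> 0 \<noteq> 0" using dual by (simp add: dual_series_def)
  have eq: "fps_nth (\<psi> ^ n) j =
      - (of_nat n / of_nat m) * fps_nth \<phi> 0 powi (- int (m + n + j)) * fps_nth (\<phi> ^ m) j"
    if "j \<le> i" "of_nat j \<notin> group_closure S" for j
    using dual_series_power_nth_outside[OF dual mn(1) supp_within_mono[OF \<phi> that(1)] that(2)] .
  show "fps_nth (\<psi> ^ n) i =
      - (of_nat n / of_nat m) * fps_nth \<phi> 0 powi (- int (m + n + i)) * fps_nth (\<phi> ^ m) i"
    using i by (intro eq) (auto simp: supp_outside_def)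
  with i mn a show i': "i \<in> supp_outside S (\<psi> ^ n)" by (auto simp: supp_outside_def)
  have "i \<le> j" if "j \<in> supp_outside S (\<psi> ^ n)" for j
  proof (rule ccontr)
    assume "\<not> i \<le> j"
    then have j: "j < i" by simp
    have "of_nat j \<notin> group_closure S" using that by (simp add: supp_outside_def)
    with eq[of j] supp_withinD[OF \<phi> j] j that show False by (auto simp: supp_outside_def)
  qed
  with i' show "(LEAST i. i \<in> supp_outside S (\<psi> ^ n)) = i" by (intro Least_equality) auto
qed


subsection \<open>Essential exponents\<close>

lemma puiseux_nth:
  assumes "n > 0"
  shows "puiseux f n (of_nat j / of_nat n) = fps_nth f j"
  using assms by (simp add: puiseux_def)

lemma puiseux_supp_eq:
  assumes "n > 0"
  shows "puiseux_supp (puiseux f n) = {of_nat j / of_nat n | j. fps_nth f j \<noteq> 0}"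
proof (intro equalityI subsetI)
  fix r assume r: "r \<in> puiseux_supp (puiseux f n)"
  then have "of_nat n * r \<in> \<nat>" by (auto simp: puiseux_supp_def puiseux_def split: if_splits)
  then obtain j where "of_nat n * r = of_nat j" by (auto elim: Nats_cases)
  with assms have "r = of_nat j / of_nat n" by (simp add: field_simps)
  with r show "r \<in> {of_nat j / of_nat n | j. fps_nth f j \<noteq> 0}"
    by (auto simp: puiseux_supp_def puiseux_nth[OF assms])
qed (auto simp: puiseux_supp_def puiseux_nth[OF assms])

lemma puiseux_X_power_mult_nth:
  assumes "n > 0"
  shows "puiseux ((fps_X * \<phi>) ^ m) n (of_nat (m + i) / of_nat n) = fps_nth ((\<phi> :: 'a::comm_ring_1 fps) ^ m) i"
  unfolding puiseux_nth[OF assms] by (simp add: power_mult_distrib fps_X_power_mult_nth)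

lemma puiseux_supp_X_power_mult:
  fixes \<phi> :: "'a::comm_ring_1 fps"
  assumes "n > 0"
  shows "puiseux_supp (puiseux ((fps_X * \<phi>) ^ m) n) =
    (\<lambda>i. of_nat (m + i) / of_nat n) ` {i. fps_nth (\<phi> ^ m) i \<noteq> 0}"
proof -
  have "fps_nth ((fps_X * \<phi>) ^ m) j \<noteq> 0 \<longleftrightarrow> (\<exists>i. j = m + i \<and> fps_nth (\<phi> ^ m) i \<noteq> 0)" for j
    by (auto simp: power_mult_distrib fps_X_power_mult_nth intro!: exI[of _ "j - m"])
  then show ?thesis unfolding puiseux_supp_eq[OF assms] by (auto simp: setcompr_eq_image image_image)
qed

lemma Least_image_shift:
  fixes I :: "nat set"
  assumes "n > 0" "I \<noteq> {}"
  shows "(LEAST r. r \<in> (\<lambda>i. rat_of_nat (m + i) / of_nat n) ` I) = of_nat (m + (LEAST i. i \<in> I)) / of_nat n"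
proof (rule Least_equality)
  show "of_nat (m + (LEAST i. i \<in> I)) / of_nat n \<in> (\<lambda>i. rat_of_nat (m + i) / of_nat n) ` I"
    using assms(2) by (auto intro: LeastI)
  show "of_nat (m + (LEAST i. i \<in> I)) / of_nat n \<le> r"
    if "r \<in> (\<lambda>i. rat_of_nat (m + i) / of_nat n) ` I" for r
    using that by (auto intro!: divide_right_mono Least_le)
qed

section \<open>Rescaled subgroups and the choice of the next essential exponent\<close>

lemma group_closure_mult_iff:
  fixes c :: rat
  assumes "c \<noteq> 0"
  shows "c * r \<in> group_closure ((*) c ` S) \<longleftrightarrow> r \<in> group_closure S"
proof -
  have mult: "d * x \<in> group_closure ((*) d ` T)" if "x \<in> group_closure T" for d x :: rat and T
    using that
    by induction (auto simp: right_diff_distrib intro: group_closure.intros)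
  have "(*) (inverse c) ` ((*) c ` S) = S"
    using assms by (simp add: image_image mult.assoc[symmetric])
  with mult[of "c * r" "(*) c ` S" "inverse c"] mult[of r S c] assms show ?thesis
    by (auto simp: mult.assoc[symmetric])
qed

lemma group_closure_subset: "A \<subseteq> group_closure B \<Longrightarrow> group_closure A \<subseteq> group_closure B"
proof
  fix x assume "x \<in> group_closure A" "A \<subseteq> group_closure B"
  then show "x \<in> group_closure B"
    by induction (auto intro: group_closure.intros)
qed

text \<open>Used when the new rescaled exponents \<open>x\<close> and \<open>y\<close> of the two
  series differ but are congruent modulo the common subgroup found so far.\<close>

lemma group_closure_insert_cong:
  assumes eq: "group_closure A = group_closure B" and d: "x - y \<in> group_closure A"
  shows "group_closure (insert x A) = group_closure (insert y B)"
proof (intro equalityI group_closure_subset)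
  have sub: "group_closure A \<subseteq> group_closure (insert z A)"
    "group_closure B \<subseteq> group_closure (insert z B)" for z
    by (rule group_closure_mono, blast)+
  have "y + (x - y) \<in> group_closure (insert y B)"
    using d sub(2) eq by (intro group_closure_add) (auto intro: group_closure.base)
  then show "insert x A \<subseteq> group_closure (insert y B)"
    using sub(2) eq by (auto intro: group_closure.base)
  have "x - (x - y) \<in> group_closure (insert x A)"
    using d sub(1) by (intro group_closure.diff[of x _ "x - y"]) (auto intro: group_closure.base)
  then have "y \<in> group_closure (insert x A)" by simp
  then show "insert y B \<subseteq> group_closure (insert x A)"
    using sub(1)[of x] group_closure.base[of _ B] eq by (auto intro: group_closure.base)
qed

text \<open>Scaling by \<open>n\<close> turns the exponent \<open>(m + i) / n\<close> into
  \<open>m + i\<close>; as \<open>m\<close> lies in the subgroup, \<open>i\<close> alone decides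
  membership. \<open>S\<close> may be any generating set of the scaled group, so both series can be
  compared over the same \<open>S\<close>.\<close>

lemma ess_rest_X_power_mult:
  fixes \<phi> :: "'a::comm_ring_1 fps"
  assumes n: "n > 0"
    and H: "group_closure ((*) (of_nat n) ` insert 1 (set es)) = group_closure S"
    and m: "of_nat m \<in> group_closure S"
  shows "ess_rest (puiseux_supp (puiseux ((fps_X * \<phi>) ^ m) n)) 1 es =
    (\<lambda>i. of_nat (m + i) / of_nat n) ` supp_outside S (\<phi> ^ m)"
proof -
  have "of_nat (m + i) / of_nat n \<in> group_closure (insert 1 (set es)) \<longleftrightarrow> of_nat i \<in> group_closure S" for i
  proof -
    have "of_nat (m + i) / of_nat n \<in> group_closure (insert 1 (set es)) \<longleftrightarrow>
        of_nat n * (of_nat (m + i) / of_nat n) \<in> group_closure S"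
      unfolding H[symmetric] using n by (intro group_closure_mult_iff[symmetric]) auto
    also have "\<dots> \<longleftrightarrow> of_nat m + of_nat i \<in> group_closure S" using n by simp
    also have "\<dots> \<longleftrightarrow> of_nat i \<in> group_closure S"
      using group_closure_add[OF m, of "of_nat i"] group_closure.diff[of "of_nat m + of_nat i" S "of_nat m"] m
      by auto
    finally show ?thesis .
  qed
  then show ?thesis
    unfolding ess_rest_def puiseux_supp_X_power_mult[OF n] supp_outside_def by auto
qed

lemma is_ess_puiseux:
  fixes \<phi> :: "'a::idom fps"
  assumes "n > 0" "fps_nth \<phi> 0 \<noteq> 0"
    and "ess (puiseux_supp (puiseux ((fps_X * \<phi>) ^ m) n)) 1 = es"
  shows "is_ess (puiseux_supp (puiseux ((fps_X * \<phi>) ^ m) n)) 1 es"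
    and "es ! 0 = of_nat m / of_nat n"
proof -
  let ?E = "puiseux_supp (puiseux ((fps_X * \<phi>) ^ m) n)"
  have 0: "0 \<in> {i. fps_nth (\<phi> ^ m) i \<noteq> 0}" using assms(2) by (simp add: fps_nth_power_0)
  have "?E \<noteq> {}" unfolding puiseux_supp_X_power_mult[OF assms(1)] using 0 by blast
  moreover have "?E \<subseteq> {of_nat j / of_nat n | j. True}"
    unfolding puiseux_supp_eq[OF assms(1)] by auto
  ultimately show ess: "is_ess ?E 1 es"
    using is_ess_ess[OF assms(1), of ?E 1] assms(3) by auto
  have "es ! 0 = (LEAST r. r \<in> ?E)" using ess by (simp add: is_ess_def)
  also have "\<dots> = of_nat (m + (LEAST i. i \<in> {i. fps_nth (\<phi> ^ m) i \<noteq> 0})) / of_nat n"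
    unfolding puiseux_supp_X_power_mult[OF assms(1)] using 0 by (intro Least_image_shift[OF assms(1)]) blast
  also have "(LEAST i. i \<in> {i. fps_nth (\<phi> ^ m) i \<noteq> 0}) = 0"
    using 0 by (intro Least_equality) auto
  finally show "es ! 0 = of_nat m / of_nat n" by simp
qed

section \<open>Simultaneous induction along both essential sequences\<close>

lemma is_ess_rest_nonempty_iff:
  assumes "is_ess E p es" "1 \<le> l" "l \<le> length es"
  shows "ess_rest E p (take l es) \<noteq> {} \<longleftrightarrow> l < length es"
  using assms by (cases "l = length es") (auto simp: is_ess_def)

lemma is_ess_nth:
  "is_ess E p es \<Longrightarrow> 1 \<le> l \<Longrightarrow> l < length es \<Longrightarrow> es ! l = (LEAST r. r \<in> ess_rest E p (take l es))"
  by (auto simp: is_ess_def)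

text \<open>Invariant: the first \<open>l\<close> essential exponents with \<open>1\<close>, scaled
  by \<open>n\<close> for the first series and by \<open>m\<close> for the second, generate the same
  subgroup. The next exponents then come from the same least \<open>i\<close>.\<close>

lemma ess_dual_series:
  fixes \<phi> \<psi> :: "'a::field_char_0 fps"
  assumes dual: "dual_series \<phi> \<psi>" and mn: "m > 0" "n > 0"
    and es: "is_ess (puiseux_supp (puiseux ((fps_X * \<phi>) ^ m) n)) 1 es" "es ! 0 = of_nat m / of_nat n"
    and es': "is_ess (puiseux_supp (puiseux ((fps_X * \<psi>) ^ n) m)) 1 es'" "es' ! 0 = of_nat n / of_nat m"
  shows "length es' = length es"
    and "1 \<le> l \<Longrightarrow> l < length es \<Longrightarrow> \<exists>i. es ! l = of_nat (m + i) / of_nat n \<and> es' ! l = of_nat (n + i) / of_nat m \<and>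
      fps_nth (\<psi> ^ n) i =
        - (of_nat n / of_nat m) * fps_nth \<phi> 0 powi (- int (m + n + i)) * fps_nth (\<phi> ^ m) i"
proof -
  let ?E = "puiseux_supp (puiseux ((fps_X * \<phi>) ^ m) n)"
  let ?E' = "puiseux_supp (puiseux ((fps_X * \<psi>) ^ n) m)"
  let ?S = "\<lambda>l. (*) (of_nat n) ` insert 1 (set (take l es))"
  let ?S' = "\<lambda>l. (*) (of_nat m) ` insert 1 (set (take l es'))"
  have ne: "es \<noteq> []" "es' \<noteq> []" using es(1) es'(1) by (auto simp: is_ess_def)
  \<comment> \<open>After scaling by \<open>n\<close>, the generator \<open>1\<close> contributes
    \<open>n\<close> and the initial exponent \<open>m / n\<close> contributes
    \<open>m\<close>.\<close>
  have m: "of_nat m \<in> group_closure (?S l)" and n: "of_nat n \<in> group_closure (?S l)" if "1 \<le> l" for l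
  proof -
    have "of_nat n * (es ! 0) \<in> ?S l"
      using that ne by (intro imageI) (cases es; cases l; auto)
    then show "of_nat m \<in> group_closure (?S l)" using es(2) mn by (auto intro: group_closure.base)
    show "of_nat n \<in> group_closure (?S l)" by (auto intro: group_closure.base)
  qed
  have next_ess: "(l < length es \<longleftrightarrow> l < length es') \<and> (l < length es \<longrightarrow>
      (\<exists>i. es ! l = of_nat (m + i) / of_nat n \<and> es' ! l = of_nat (n + i) / of_nat m \<and>
      fps_nth (\<psi> ^ n) i =
        - (of_nat n / of_nat m) * fps_nth \<phi> 0 powi (- int (m + n + i)) * fps_nth (\<phi> ^ m) i))"
    if l: "1 \<le> l" "l \<le> length es" "l \<le> length es'" and S: "group_closure (?S' l) = group_closure (?S l)" for l
  proof -
    let ?I = "supp_outside (?S l) (\<phi> ^ m)" and ?I' = "supp_outside (?S l) (\<psi> ^ n)"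
    have rest: "ess_rest ?E 1 (take l es) = (\<lambda>i. of_nat (m + i) / of_nat n) ` ?I"
      by (rule ess_rest_X_power_mult[OF mn(2) refl m[OF l(1)]])
    have rest': "ess_rest ?E' 1 (take l es') = (\<lambda>i. of_nat (n + i) / of_nat m) ` ?I'"
      by (rule ess_rest_X_power_mult[OF mn(1) S n[OF l(1)]])
    \<comment> \<open>Duality is symmetric, so the transfer of the first outside exponent also runs
      from \<open>\<psi> ^ n\<close> to \<open>\<phi> ^ m\<close>.\<close>
    have iff: "?I \<noteq> {} \<longleftrightarrow> ?I' \<noteq> {}"
      using dual_series_Least_supp_outside(1)[OF dual mn]
        dual_series_Least_supp_outside(1)[OF dual_series_sym[OF dual] mn(2,1)] by blast
    have len: "?I \<noteq> {} \<longleftrightarrow> l < length es" "?I' \<noteq> {} \<longleftrightarrow> l < length es'"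
      using is_ess_rest_nonempty_iff[OF es(1) l(1,2)] is_ess_rest_nonempty_iff[OF es'(1) l(1,3)]
      unfolding rest rest' by auto
    have "\<exists>i. es ! l = of_nat (m + i) / of_nat n \<and> es' ! l = of_nat (n + i) / of_nat m \<and>
      fps_nth (\<psi> ^ n) i =
        - (of_nat n / of_nat m) * fps_nth \<phi> 0 powi (- int (m + n + i)) * fps_nth (\<phi> ^ m) i"
      if "l < length es"
    proof (intro exI conjI)
      let ?i = "LEAST i. i \<in> ?I"
      have I: "?I \<noteq> {}" "?I' \<noteq> {}" using that len iff by auto
      show "es ! l = of_nat (m + ?i) / of_nat n"
        unfolding is_ess_nth[OF es(1) l(1) that] rest by (rule Least_image_shift[OF mn(2) I(1)])
      have "l < length es'" using I len by simp
      then show "es' ! l = of_nat (n + ?i) / of_nat m"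
        using is_ess_nth[OF es'(1) l(1)] Least_image_shift[OF mn(1) I(2), of n]
        unfolding rest' dual_series_Least_supp_outside(2)[OF dual mn I(1)] by simp
      show "fps_nth (\<psi> ^ n) ?i =
        - (of_nat n / of_nat m) * fps_nth \<phi> 0 powi (- int (m + n + ?i)) * fps_nth (\<phi> ^ m) ?i"
        by (rule dual_series_Least_supp_outside(3)[OF dual mn I(1)])
    qed
    with len iff show ?thesis by blast
  qed
  have S: "group_closure (?S' l) = group_closure (?S l)"
    if "1 \<le> l" "l \<le> length es" "l \<le> length es'" for l
    using that
  proof (induction l rule: dec_induct)
    case base
    \<comment> \<open>At \<open>l = 1\<close> both scaled generating sets are
      \<open>{n, m}\<close>.\<close>
    have "take 1 es = [es ! 0]" "take 1 es' = [es' ! 0]" using ne by (cases es; cases es'; simp)+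
    then have "?S' 1 = ?S 1" using es(2) es'(2) mn by auto
    then show ?case by simp
  next
    case (step l)
    from step.prems have l: "l < length es" "l < length es'" by auto
    with step.IH have IH: "group_closure (?S' l) = group_closure (?S l)" by simp
    from next_ess[OF step.hyps(1) _ _ IH] l obtain i where
      "es ! l = of_nat (m + i) / of_nat n" "es' ! l = of_nat (n + i) / of_nat m" by auto
    \<comment> \<open>The scaled exponents are \<open>n + i\<close> and \<open>m + i\<close>; their
      difference does not involve \<open>i\<close> and lies in the common subgroup.\<close>
    then have "of_nat m * (es' ! l) - of_nat n * (es ! l) = of_nat n - of_nat m"
      using mn by simp
    also have "\<dots> \<in> group_closure (?S' l)"
      unfolding IH using step.hyps(1) by (intro group_closure.diff m n)
    finally have "group_closure (insert (of_nat m * (es' ! l)) (?S' l)) =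
        group_closure (insert (of_nat n * (es ! l)) (?S l))"
      by (intro group_closure_insert_cong IH)
    moreover have "?S (Suc l) = insert (of_nat n * (es ! l)) (?S l)"
      "?S' (Suc l) = insert (of_nat m * (es' ! l)) (?S' l)"
      using l by (auto simp: take_Suc_conv_app_nth)
    ultimately show ?case by simp
  qed
  \<comment> \<open>One sequence has ended at \<open>?l\<close>, and \<open>next_ess\<close> says
    that then the other has too.\<close>
  let ?l = "min (length es) (length es')"
  have "1 \<le> ?l" using ne by (cases es; cases es'; simp)
  with next_ess[of ?l] S[of ?l] show len: "length es' = length es" by auto
  show "\<exists>i. es ! l = of_nat (m + i) / of_nat n \<and> es' ! l = of_nat (n + i) / of_nat m \<and>
      fps_nth (\<psi> ^ n) i =
        - (of_nat n / of_nat m) * fps_nth \<phi> 0 powi (- int (m + n + i)) * fps_nth (\<phi> ^ m) i"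
    if "1 \<le> l" "l < length es"
    using next_ess[OF that(1)] S[OF that(1)] that len by simp
qed

theorem corollary4p5:
  fixes f :: "'a::{alg_closed_field, field_char_0} fps fps"
    and \<eta> \<xi> \<eta>t \<xi>t :: "'a fps" and a :: 'a
    and m n d d' :: nat and e e' :: "nat \<Rightarrow> rat"
  assumes "irreducible f"
    and "m > 0" and "n > 0"
    and "puiseux \<eta> n \<in> newton_puiseux_series f"
    and "puiseux \<xi> m \<in> newton_puiseux_series (fps_swap f)"
    and "\<eta> = (fps_X * \<eta>t) ^ m"
    and "\<xi> = (fps_X * \<xi>t) ^ n"
    and "dual_series \<eta>t \<xi>t"
    and "fps_nth \<eta>t 0 = a"
    and "ess (puiseux_supp (puiseux \<eta> n)) 1 = map e [0..<Suc d]"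
    and "ess (puiseux_supp (puiseux \<xi> m)) 1 = map e' [0..<Suc d']"
  shows "e 0 = of_nat m / of_nat n \<and> e' 0 = of_nat n / of_nat m
    \<and> d' = d
    \<and> (\<forall>k\<in>{1..d}. of_nat m * (1 + e' k) = of_nat n * (1 + e k))
    \<and> puiseux \<xi> m (of_nat n / of_nat m) = a powi (- int n)
    \<and> (\<forall>k\<in>{1..d}.
         (1 + e k) * of_nat n \<in> \<int> \<and>
         puiseux \<xi> m (e' k) =
           - (of_nat n / of_nat m) * a powi (- \<lfloor>(1 + e k) * of_nat n\<rfloor>) * puiseux \<eta> n (e k))"
proof -
  let ?es = "map e [0..<Suc d]" and ?es' = "map e' [0..<Suc d']"
  note dual = \<open>dual_series \<eta>t \<xi>t\<close> and mn = \<open>m > 0\<close> \<open>n > 0\<close>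
  have a: "a \<noteq> 0" "fps_nth \<xi>t 0 \<noteq> 0"
    and a_inv: "fps_nth \<xi>t 0 = inverse a"
    using dual dual_series_nth_0[OF dual] \<open>fps_nth \<eta>t 0 = a\<close>
    by (auto simp: dual_series_def field_simps)
  have es: "is_ess (puiseux_supp (puiseux ((fps_X * \<eta>t) ^ m) n)) 1 ?es" "?es ! 0 = of_nat m / of_nat n"
    using is_ess_puiseux[of n \<eta>t m ?es] assms a by auto
  have es': "is_ess (puiseux_supp (puiseux ((fps_X * \<xi>t) ^ n) m)) 1 ?es'" "?es' ! 0 = of_nat n / of_nat m"
    using is_ess_puiseux[of m \<xi>t n ?es'] assms a by auto
  note main = ess_dual_series[OF dual mn es es']
  have nth: "?es ! k = e k" if "k \<le> d" for k
    using that by (simp del: upt_Suc)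
  have nth': "?es' ! k = e' k" if "k \<le> d'" for k
    using that by (simp del: upt_Suc)
  have d: "d' = d" using main(1) by simp
  have "of_nat m * (1 + e' k) = of_nat n * (1 + e k) \<and> (1 + e k) * of_nat n \<in> \<int> \<and>
      puiseux \<xi> m (e' k) =
        - (of_nat n / of_nat m) * a powi (- \<lfloor>(1 + e k) * of_nat n\<rfloor>) * puiseux \<eta> n (e k)"
    if k: "k \<in> {1..d}" for k
  proof -
    from main(2)[of k] k d nth[of k] nth'[of k] obtain i where
      i: "e k = of_nat (m + i) / of_nat n" "e' k = of_nat (n + i) / of_nat m"
      and c: "fps_nth (\<xi>t ^ n) i =
        - (of_nat n / of_nat m) * fps_nth \<eta>t 0 powi (- int (m + n + i)) * fps_nth (\<eta>t ^ m) i"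
      by auto
    \<comment> \<open>The number is an integer, so the floor in the statement is exact and equals
      the exponent \<open>m + n + i\<close> of \<open>ess_dual_series\<close>.\<close>
    have ek: "(1 + e k) * of_nat n = of_int (int (m + n + i))"
      using mn by (simp add: i field_simps)
    then have "\<lfloor>(1 + e k) * of_nat n\<rfloor> = int (m + n + i)" by (simp only: floor_of_int)
    moreover have "puiseux \<xi> m (e' k) = fps_nth (\<xi>t ^ n) i" "puiseux \<eta> n (e k) = fps_nth (\<eta>t ^ m) i"
      unfolding i \<open>\<eta> = _\<close> \<open>\<xi> = _\<close> using mn by (simp_all only: puiseux_X_power_mult_nth)
    moreover have "of_nat m * (1 + e' k) = of_nat n * (1 + e k)"
      using mn by (simp add: i field_simps)
    moreover have "(1 + e k) * of_nat n \<in> \<int>" unfolding ek by simp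
    ultimately show ?thesis using c \<open>fps_nth \<eta>t 0 = a\<close> by simp
  qed
  \<comment> \<open>The leading coefficient is the case \<open>i = 0\<close> of the shift: the
    constant term of \<open>\<xi>t ^ n\<close>, where \<open>\<xi>t\<close> has constant term
    \<open>inverse a\<close>.\<close>
  moreover have "puiseux \<xi> m (of_nat n / of_nat m) = a powi (- int n)"
    using puiseux_X_power_mult_nth[OF mn(1), of \<xi>t n 0] a_inv
    by (simp add: \<open>\<xi> = _\<close> fps_nth_power_0 power_int_minus power_inverse)
  ultimately show ?thesis
    using d nth[of 0] nth'[of 0] es(2) es'(2) by auto
qed

end
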